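(* There is a randomized algorithm which, on input a positive integer $k$, with $n=\left\lfloor\sqrt{k/3}\,2^{(k-1)/2}\right\rfloor$: always outputs either a $2$-coloring of $\{1,\ldots,n\}$ with no monochromatic $k$-AP or the statement "I HAVE FAILED"; outputs such a coloring with probability at least $2/3$; and terminates in time polynomial in $\sqrt{k/3}\,2^{(k-1)/2}$. In particular $W(k,2)\ge \sqrt{k/3}\,2^{(k-1)/2}$.
   Context: A $k$-AP is a set $\{a,a+d,\ldots,a+(k-1)d\}$ with $a,d$ positive integers. A $2$-coloring $COL:\{1,\ldots,n\}\to\{0,1\}$ is proper if no $k$-AP contained in $\{1,\ldots,n\}$ is monochromatic. $W(k,2)$ is the least $W$ such that every $2$-coloring of $\{1,\ldots,W\}$ contains a monochromatic $k$-AP. (The paper calls such a proof "randomized-constructive".) *)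

theory Defs
  imports "HOL-Probability.Probability" "HOL-Computational_Algebra.Polynomial"
begin

section \<open>Arithmetic progressions, colorings, van der Waerden numbers\<close>

definition is_AP :: "nat \<Rightarrow> nat set \<Rightarrow> bool" where
  "is_AP k S \<longleftrightarrow> (\<exists>a d. a > 0 \<and> d > 0 \<and> S = (\<lambda>i. a + i * d) ` {0..<k})"

definition two_coloring :: "nat \<Rightarrow> (nat \<Rightarrow> nat) \<Rightarrow> bool" where
  "two_coloring n COL \<longleftrightarrow> COL \<in> {1..n} \<rightarrow> {0, 1}"

definition monochromatic :: "(nat \<Rightarrow> nat) \<Rightarrow> nat set \<Rightarrow> bool" where
  "monochromatic COL S \<longleftrightarrow> (\<exists>c. \<forall>x\<in>S. COL x = c)"

definition has_mono_AP :: "nat \<Rightarrow> nat \<Rightarrow> (nat \<Rightarrow> nat) \<Rightarrow> bool" where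
  "has_mono_AP k n COL \<longleftrightarrow> (\<exists>S. is_AP k S \<and> S \<subseteq> {1..n} \<and> monochromatic COL S)"

definition proper_coloring :: "nat \<Rightarrow> nat \<Rightarrow> (nat \<Rightarrow> nat) \<Rightarrow> bool" where
  "proper_coloring k n COL \<longleftrightarrow> two_coloring n COL \<and> \<not> has_mono_AP k n COL"

text \<open>The least element exists by van der Waerden's theorem.\<close>

definition vdW2 :: "nat \<Rightarrow> nat" where
  "vdW2 k = (LEAST W. \<forall>COL. two_coloring W COL \<longrightarrow> has_mono_AP k W COL)"

definition vdW_bound :: "nat \<Rightarrow> real" where
  "vdW_bound k = sqrt (real k / 3) * 2 powr ((real k - 1) / 2)"

section \<open>Randomized algorithms\<close>

text \<open>
  An algorithm is a program for a random access machine with registers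
  holding natural numbers, indirect addressing, a fair coin and a write-only output tape.
  Every instruction costs one time unit.  Multiplication is deliberately not an instruction:
  with addition and (truncated) subtraction only, register contents have bit length at most linear in the number of
  steps and the size of the input, so that unit-cost time is polynomially related to Turing machine time.
\<close>

datatype instr =
    Const nat nat    \<comment> \<open>\<open>R[r] := c\<close>\<close>
  | Add nat nat nat  \<comment> \<open>\<open>R[r] := R[s] + R[t]\<close>\<close>
  | Sub nat nat nat  \<comment> \<open>\<open>R[r] := R[s] - R[t]\<close>, truncated at 0\<close>
  | Load nat nat     \<comment> \<open>\<open>R[r] := R[R[s]]\<close>\<close>
  | Store nat nat    \<comment> \<open>\<open>R[R[r]] := R[s]\<close>\<close>
  | Flip nat         \<comment> \<open>\<open>R[r] :=\<close> uniformly random element of \<open>{0, 1}\<close>, independent of the past\<close>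
  | Print nat        \<comment> \<open>append \<open>R[r]\<close> to the output tape\<close>
  | JumpZero nat nat \<comment> \<open>if \<open>R[r] = 0\<close> continue at instruction number \<open>l\<close>\<close>

type_synonym program = "instr list"

record config =
  pc :: nat
  reg :: "nat \<Rightarrow> nat"
  tape :: "nat list"

definition set_reg :: "nat \<Rightarrow> nat \<Rightarrow> config \<Rightarrow> config" where
  "set_reg r v c = c\<lparr>pc := Suc (pc c), reg := (reg c)(r := v)\<rparr>"

fun exec_instr :: "instr \<Rightarrow> config \<Rightarrow> config pmf" where
  "exec_instr (Const r v) c = return_pmf (set_reg r v c)"
| "exec_instr (Add r s t) c = return_pmf (set_reg r (reg c s + reg c t) c)"
| "exec_instr (Sub r s t) c = return_pmf (set_reg r (reg c s - reg c t) c)"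
| "exec_instr (Load r s) c = return_pmf (set_reg r (reg c (reg c s)) c)"
| "exec_instr (Store r s) c = return_pmf (set_reg (reg c r) (reg c s) c)"
| "exec_instr (Flip r) c = map_pmf (\<lambda>b. set_reg r (of_bool b) c) (bernoulli_pmf (1 / 2))"
| "exec_instr (Print r) c = return_pmf (c\<lparr>pc := Suc (pc c), tape := tape c @ [reg c r]\<rparr>)"
| "exec_instr (JumpZero r l) c =
     return_pmf (c\<lparr>pc := (if reg c r = 0 then l else Suc (pc c))\<rparr>)"

definition halted :: "program \<Rightarrow> config \<Rightarrow> bool" where
  "halted P c \<longleftrightarrow> length P \<le> pc c"

definition step :: "program \<Rightarrow> config \<Rightarrow> config pmf" where
  "step P c = (if halted P c then return_pmf c else exec_instr (P ! pc c) c)"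

fun run :: "program \<Rightarrow> nat \<Rightarrow> config \<Rightarrow> config pmf" where
  "run P 0 c = return_pmf c"
| "run P (Suc t) c = bind_pmf (step P c) (run P t)"

text \<open>The input is placed in register 0; all other registers are 0.\<close>

definition initial :: "nat \<Rightarrow> config" where
  "initial k = \<lparr>pc = 0, reg = (\<lambda>_. 0)(0 := k), tape = []\<rparr>"

text \<open>The time bound is worst case over all outcomes of the coin flips.\<close>

definition terminates_within :: "program \<Rightarrow> nat \<Rightarrow> nat \<Rightarrow> bool" where
  "terminates_within P k t \<longleftrightarrow> (\<forall>c \<in> set_pmf (run P t (initial k)). halted P c)"

text \<open>
  Distribution of the output tape after \<open>t\<close> steps.  Halted configurations do not change, so
  this is the distribution of the final output as soon as \<open>terminates_within P k t\<close> holds.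
\<close>

definition output_dist :: "program \<Rightarrow> nat \<Rightarrow> nat \<Rightarrow> nat list pmf" where
  "output_dist P k t = map_pmf tape (run P t (initial k))"

text \<open>
  Encoding of answers on the tape: the first cell is 0 for ``I HAVE FAILED'', and 1 if a coloring
  follows, listed as \<open>COL 1, \<dots>, COL n\<close>.
\<close>

definition failure_word :: "nat list" where
  "failure_word = [0]"

definition coloring_word :: "nat \<Rightarrow> (nat \<Rightarrow> nat) \<Rightarrow> nat list" where
  "coloring_word n COL = 1 # map COL [1..<Suc n]"

definition proper_coloring_words :: "nat \<Rightarrow> nat \<Rightarrow> nat list set" where
  "proper_coloring_words k n = {coloring_word n COL | COL. proper_coloring k n COL}"

end

theory Submission
  imports Defs
begin

text \<open>
  A uniformly random coloring of \<open>{1..n}\<close> is proper with probability at least \<open>2 / 3\<close>: there are at most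
  \<open>n\<^sup>2 / (2 (k - 1))\<close> progressions, each monochromatic with probability \<open>2 / 2 ^ k\<close>, and
  \<open>3 n\<^sup>2 \<le> k 2 ^ (k - 1)\<close>.  Hence it suffices to flip \<open>n\<close> coins, to test all progressions and to
  print the coloring if none is monochromatic.  The machine finds \<open>n\<close> without multiplication or
  square roots, as the largest number with \<open>3 n\<^sup>2 \<le> k 2 ^ (k - 1)\<close>, by repeated doubling and by adding
  up the differences \<open>6 m + 3\<close> of \<open>3 m\<^sup>2\<close>.  The lower bound on \<open>vdW2 k\<close> follows because a proper coloring
  exists; as \<open>vdW2 k\<close> is a \<open>LEAST\<close>, this also needs van der Waerden's theorem.
\<close>

section \<open>Van der Waerden's theorem\<close>

text \<open>
  Color focusing: either there is a monochromatic progression of length \<open>k + 1\<close>, or there are \<open>s\<close>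
  progressions of length \<open>k\<close>, monochromatic in \<open>s\<close> different colors, that would all be continued by the
  same focus \<open>f\<close>.  For \<open>s = r\<close> the color of \<open>f\<close> continues one of them.  The bound \<open>a + k * d < N\<close>
  (rather than \<open>k - 1\<close>) keeps the focus inside the interval.
\<close>

lemma van_der_Waerden_nat:
  fixes k r :: nat
  shows "\<exists>N. \<forall>c::nat \<Rightarrow> nat. (\<forall>x. c x < r) \<longrightarrow>
           (\<exists>a d. d > 0 \<and> a + k * d < N \<and> (\<forall>i<k. c (a + i * d) = c a))"
proof (induction k arbitrary: r)
  case 0
  have "(1::nat) > 0 \<and> 0 + 0 * (1::nat) < (1::nat) \<and> (\<forall>i<0. c (0 + i * 1) = c 0)" for c :: "nat \<Rightarrow> nat"
    by simp
  then show ?case by blast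
next
  case (Suc k)
  note IH = Suc.IH
  define long where "long N c \<longleftrightarrow>
      (\<exists>a d. d > 0 \<and> a + k * d < N \<and> (\<forall>i\<le>k. c (a + i * d) = c a))" for N and c :: "nat \<Rightarrow> nat"
  define focused where "focused c f \<Gamma> \<longleftrightarrow>
      (\<forall>\<gamma>\<in>\<Gamma>. \<exists>a d. d > 0 \<and> a + k * d = f \<and> (\<forall>i<k. c (a + i * d) = \<gamma>))"
    for c :: "nat \<Rightarrow> nat" and f :: nat and \<Gamma> :: "nat set"
  have focus_hit: "long N c" if foc: "focused c f \<Gamma>" and "f < N" "c f \<in> \<Gamma>" for N c f \<Gamma>
  proof -
    obtain a d where ad: "d > 0" "a + k * d = f" "\<forall>i<k. c (a + i * d) = c f"
      using bspec[OF foc[unfolded focused_def] \<open>c f \<in> \<Gamma>\<close>] by auto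
    have "c (a + i * d) = c f" if "i \<le> k" for i
      using ad that by (cases "i = k") auto
    then have "\<forall>i\<le>k. c (a + i * d) = c a"
      by (metis add.right_neutral le0 mult_0)
    then show ?thesis
      unfolding long_def using ad(1,2) \<open>f < N\<close> by blast
  qed
  \<comment> \<open>Inner induction on the number \<open>s\<close> of focused colors. That the
    progressions have different colors is recorded by collecting the colors in a set
    \<open>\<Gamma>\<close> with \<open>s\<close> elements.\<close>
  have "\<exists>N. \<forall>c. (\<forall>x. c x < r) \<longrightarrow>
          long N c \<or> (\<exists>f<N. \<exists>\<Gamma>. finite \<Gamma> \<and> card \<Gamma> = s \<and> \<Gamma> \<subseteq> {..<r} \<and> focused c f \<Gamma>)" for s
  proof (induction s)
    case 0
    have "(0::nat) < 1 \<and> finite {} \<and> card {} = 0 \<and> {} \<subseteq> {..<r} \<and> focused c 0 {}" for c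
      by (simp add: focused_def)
    then show ?case by blast
  next
    case (Suc s)
    then obtain N where N: "\<And>c. (\<forall>x. c x < r) \<Longrightarrow> long N c \<or>
        (\<exists>f<N. \<exists>\<Gamma>. finite \<Gamma> \<and> card \<Gamma> = s \<and> \<Gamma> \<subseteq> {..<r} \<and> focused c f \<Gamma>)"
      by blast
    \<comment> \<open>Blocks of length \<open>N\<close> are colored by their color patterns, encoded as numbers by \<open>g\<close>.\<close>
    define L where "L = {xs. set xs \<subseteq> {..<r} \<and> length xs = N}"
    have "finite L" unfolding L_def by (intro finite_lists_length_eq) auto
    then obtain g :: "nat list \<Rightarrow> nat" and R where g: "g ` L = {i. i < R}" "inj_on g L"
      using finite_imp_inj_to_nat_seg by blast
    \<comment> \<open>The outer hypothesis is applied to block numbers, with one color for each of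
      the \<open>R\<close> block patterns. It gives \<open>k\<close> equally spaced identical
      blocks, and its bound \<open>a + k * d < M\<close> leaves room for one block more, which will
      contain the new focus.\<close>
    obtain M where M: "\<And>c::nat \<Rightarrow> nat. (\<forall>x. c x < R) \<Longrightarrow>
        (\<exists>a d. d > 0 \<and> a + k * d < M \<and> (\<forall>i<k. c (a + i * d) = c a))"
      using IH[of R] by blast
    show ?case
    proof (intro exI[of _ "M * N"] allI impI)
      fix c :: "nat \<Rightarrow> nat"
      assume c: "\<forall>x. c x < r"
      define block where "block x = map (\<lambda>j. c (x * N + j)) [0..<N]" for x
      have block: "block x \<in> L" for x
        unfolding block_def L_def using c by auto
      then have "\<forall>x. g (block x) < R" using g(1) by blast
      from M[OF this] obtain b e where be: "e > 0" "b + k * e < M"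
        and "\<forall>i<k. g (block (b + i * e)) = g (block b)" by blast
      then have eq: "block (b + i * e) = block b" if "i < k" for i
        using that g(2) block by (meson inj_onD)
      have shift: "c ((b + i * e) * N + j) = c (b * N + j)" if "i < k" "j < N" for i j
      proof -
        have "block (b + i * e) ! j = block b ! j" using eq that by simp
        then show ?thesis using that by (simp add: block_def)
      qed
      have blk: "x * N + j < M * N" if "x < M" "j < N" for x j
      proof -
        have "x * N + j < Suc x * N" using that by simp
        also have "\<dots> \<le> M * N" using that by (intro mult_right_mono) auto
        finally show ?thesis .
      qed
      have bM: "b < M" using be by simp
      have long_shift: "long (M * N) c" if lng: "long N (\<lambda>x. c (b * N + x))"
      proof -
        obtain a d where "d > 0" "a + k * d < N" "\<forall>i\<le>k. c (b * N + (a + i * d)) = c (b * N + a)"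
          using lng unfolding long_def by blast
        then have "d > 0 \<and> b * N + a + k * d < M * N \<and> (\<forall>i\<le>k. c (b * N + a + i * d) = c (b * N + a))"
          using blk[OF bM] by (simp add: add.assoc)
        then show ?thesis unfolding long_def by blast
      qed
      show "long (M * N) c \<or>
        (\<exists>f<M * N. \<exists>\<Gamma>. finite \<Gamma> \<and> card \<Gamma> = Suc s \<and> \<Gamma> \<subseteq> {..<r} \<and> focused c f \<Gamma>)"
      proof (cases "long N (\<lambda>x. c (b * N + x))")
        case True
        then show ?thesis using long_shift by blast
      next
        case False
        then obtain f \<Gamma> where f: "f < N" and \<Gamma>: "finite \<Gamma>" "card \<Gamma> = s" "\<Gamma> \<subseteq> {..<r}"
          and foc: "focused (\<lambda>x. c (b * N + x)) f \<Gamma>"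
          using N[of "\<lambda>x. c (b * N + x)"] c by blast
        \<comment> \<open>A focus colored from \<open>\<Gamma>\<close> would complete a long
          progression inside block \<open>b\<close>, which \<open>False\<close> excludes. So
          \<open>c (b * N + f)\<close> is an additional color.\<close>
        have new: "c (b * N + f) \<notin> \<Gamma>"
          using focus_hit[OF foc f] False by blast
        \<comment> \<open>The new focus is the copy of \<open>f\<close> in block
          \<open>b + k * e\<close>. The copies of \<open>f\<close> in the \<open>k\<close> identical
          blocks form the progression of the new color. An old progression with difference
          \<open>d\<close> gets difference \<open>d + e * N\<close>, moving on by one block with
          each term.\<close>
        have "focused c ((b + k * e) * N + f) (insert (c (b * N + f)) \<Gamma>)"
          unfolding focused_def
        proof (intro ballI)
          fix \<gamma> assume "\<gamma> \<in> insert (c (b * N + f)) \<Gamma>"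
          then consider "\<gamma> = c (b * N + f)" | "\<gamma> \<in> \<Gamma>" by blast
          then show "\<exists>a d. d > 0 \<and> a + k * d = (b + k * e) * N + f \<and> (\<forall>i<k. c (a + i * d) = \<gamma>)"
          proof cases
            case 1
            have "c (b * N + f + i * (e * N)) = \<gamma>" if "i < k" for i
              using shift[OF that f] 1 by (simp add: algebra_simps)
            moreover have "e * N > 0" "b * N + f + k * (e * N) = (b + k * e) * N + f"
              using be f by (simp_all add: algebra_simps)
            ultimately show ?thesis by blast
          next
            case 2
            then obtain a d where ad: "d > 0" "a + k * d = f" "\<forall>i<k. c (b * N + (a + i * d)) = \<gamma>"
              using foc unfolding focused_def by blast
            have "c (b * N + a + i * (d + e * N)) = \<gamma>" if "i < k" for i
            proof -
              \<comment> \<open>\<open>shift\<close> compares positions inside blocks, so the offset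
                has to stay below \<open>N\<close>. The focus \<open>f < N\<close> bounds
                it.\<close>
              have "a + i * d \<le> a + k * d" using that by simp
              then have "a + i * d < N" using ad f by linarith
              moreover have "c (b * N + (a + i * d)) = \<gamma>" using ad(3) that by blast
              ultimately have "c ((b + i * e) * N + (a + i * d)) = \<gamma>" using shift[OF that] by simp
              then show ?thesis by (simp add: algebra_simps)
            qed
            moreover have "d + e * N > 0" "b * N + a + k * (d + e * N) = (b + k * e) * N + f"
              using ad(1,2) by (simp_all add: algebra_simps)
            ultimately show ?thesis by blast
          qed
        qed
        moreover have "(b + k * e) * N + f < M * N" using blk be f by blast
        moreover have "finite (insert (c (b * N + f)) \<Gamma>)" "card (insert (c (b * N + f)) \<Gamma>) = Suc s"
          "insert (c (b * N + f)) \<Gamma> \<subseteq> {..<r}"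
          using \<Gamma> new c by auto
        ultimately show ?thesis by blast
      qed
    qed
  qed
  from this[of r] obtain N where N: "\<And>c. (\<forall>x. c x < r) \<Longrightarrow> long N c \<or>
      (\<exists>f<N. \<exists>\<Gamma>. finite \<Gamma> \<and> card \<Gamma> = r \<and> \<Gamma> \<subseteq> {..<r} \<and> focused c f \<Gamma>)"
    by blast
  have lng: "long N c" if c: "\<forall>x. c x < r" for c
    using N[OF c]
  proof
    assume "\<exists>f<N. \<exists>\<Gamma>. finite \<Gamma> \<and> card \<Gamma> = r \<and> \<Gamma> \<subseteq> {..<r} \<and> focused c f \<Gamma>"
    then obtain f \<Gamma> where f: "f < N" "card \<Gamma> = r" "\<Gamma> \<subseteq> {..<r}" and foc: "focused c f \<Gamma>" by blast
    \<comment> \<open>With \<open>r\<close> focused colors every color is in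
      \<open>\<Gamma>\<close>, in particular that of the focus.\<close>
    then have "\<Gamma> = {..<r}" by (intro card_subset_eq) auto
    then show ?thesis using focus_hit[OF foc f(1)] c by blast
  qed
  show ?case
  \<comment> \<open>The goal asks for room for one more difference than \<open>long\<close>
    provides. For \<open>k > 0\<close> this costs at most \<open>d \<le> k * d < N\<close>. For
    \<open>k = 0\<close> the difference from \<open>long\<close> is unbounded, but a single term
    allows the difference 1.\<close>
  proof (rule exI[of _ "2 * N"], intro allI impI)
    fix c :: "nat \<Rightarrow> nat" assume "\<forall>x. c x < r"
    then have "long N c" by (rule lng)
    then obtain a d where ad: "d > 0" "a + k * d < N" "\<forall>i\<le>k. c (a + i * d) = c a"
      unfolding long_def by blast
    show "\<exists>a d. d > 0 \<and> a + Suc k * d < 2 * N \<and> (\<forall>i<Suc k. c (a + i * d) = c a)"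
    proof (cases "k = 0")
      case True
      then have "(1::nat) > 0 \<and> 0 + Suc k * 1 < 2 * N \<and> (\<forall>i<Suc k. c (0 + i * 1) = c 0)"
        using ad(2) by auto
      then show ?thesis by blast
    next
      case False
      then have "d \<le> k * d" by (cases k) auto
      moreover have "a + Suc k * d = a + k * d + d" by simp
      ultimately have "a + Suc k * d < 2 * N" using ad(2) by linarith
      then show ?thesis using ad unfolding less_Suc_eq_le by blast
    qed
  qed
qed

text \<open>The case of two colors, moved from an interval starting at 0 to
  \<open>{1..N}\<close>.\<close>

lemma van_der_Waerden:
  "\<exists>W. \<forall>COL. two_coloring W COL \<longrightarrow> has_mono_AP k W COL"
proof -
  obtain N where N: "\<And>c::nat \<Rightarrow> nat. (\<forall>x. c x < 2) \<Longrightarrow>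
      (\<exists>a d. d > 0 \<and> a + k * d < N \<and> (\<forall>i<k. c (a + i * d) = c a))"
    using van_der_Waerden_nat[of 2 k] by blast
  have "has_mono_AP k N COL" if COL: "two_coloring N COL" for COL
  proof -
    \<comment> \<open>\<open>two_coloring\<close> restricts \<open>COL\<close> only on
      \<open>{1..N}\<close>, whereas \<open>N\<close> requires values below 2 everywhere. Truncation
      by \<open>min 1\<close> achieves this and changes nothing on \<open>{1..N}\<close>.\<close>
    obtain a d where ad: "d > 0" "a + k * d < N"
      "\<forall>i<k. min 1 (COL (Suc (a + i * d))) = min 1 (COL (Suc a))"
      using N[of "\<lambda>x. min 1 (COL (Suc x))"] by force
    have le: "a + i * d < N" if "i < k" for i
    proof -
      have "i * d \<le> k * d" using that by simp
      then show ?thesis using ad(2) by linarith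
    qed
    have val: "COL x \<le> 1" if "x \<in> {1..N}" for x
      using COL that funcset_mem[of COL "{1..N}" "{0, 1}" x] unfolding two_coloring_def by auto
    have "COL (Suc a + i * d) = COL (Suc a)" if "i < k" for i
      using ad(3) that val[of "Suc a + i * d"] val[of "Suc a"] le[of i] le[of 0]
      by (auto simp: min_def split: if_splits)
    moreover have "is_AP k ((\<lambda>i. Suc a + i * d) ` {0..<k})"
      unfolding is_AP_def using ad(1) by blast
    ultimately show ?thesis
      unfolding has_mono_AP_def monochromatic_def using le
      by (intro exI[of _ "(\<lambda>i. Suc a + i * d) ` {0..<k}"]) (auto simp: Suc_le_eq)
  qed
  then show ?thesis by blast
qed

text \<open>Otherwise the coloring could be restricted to \<open>{1..vdW2 k}\<close>, and the
  progression found there would also be monochromatic in \<open>{1..n}\<close>.\<close>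

lemma less_vdW2:
  assumes "proper_coloring k n COL"
  shows "n < vdW2 k"
proof (rule ccontr)
  assume "\<not> n < vdW2 k"
  then have le: "vdW2 k \<le> n" by simp
  have "\<forall>COL. two_coloring (vdW2 k) COL \<longrightarrow> has_mono_AP k (vdW2 k) COL"
    unfolding vdW2_def by (rule LeastI_ex) (rule van_der_Waerden)
  moreover have "two_coloring (vdW2 k) COL"
    using assms le unfolding proper_coloring_def two_coloring_def by (auto simp: Pi_iff)
  ultimately have "has_mono_AP k n COL"
    using le unfolding has_mono_AP_def by fastforce
  with assms show False unfolding proper_coloring_def by blast
qed

section \<open>Random colorings\<close>

abbreviation coins :: "nat \<Rightarrow> (nat \<Rightarrow> bool) pmf" where
  "coins n \<equiv> Pi_pmf {1..n} False (\<lambda>_. bernoulli_pmf (1 / 2))"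

abbreviation coloring_of :: "(nat \<Rightarrow> bool) \<Rightarrow> nat \<Rightarrow> nat" where
  "coloring_of f \<equiv> (\<lambda>x. of_bool (f x))"

definition mono_at :: "nat \<Rightarrow> (nat \<Rightarrow> bool) \<Rightarrow> nat \<Rightarrow> nat \<Rightarrow> bool" where
  "mono_at k f a d \<longleftrightarrow> (\<exists>b. \<forall>i<k. f (a + i * d) = b)"

text \<open>For \<open>k \<ge> 2\<close> the last term bounds the difference as well as the start,
  so a search over finitely many pairs suffices. This is the search that the machine
  performs.\<close>

lemma has_mono_AP_coloring_of_iff:
  assumes "k \<ge> 2"
  shows "has_mono_AP k n (coloring_of f) \<longleftrightarrow>
    (\<exists>d\<in>{1..n}. \<exists>a\<in>{1..n}. a + (k - 1) * d \<le> n \<and> mono_at k f a d)"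
proof
  assume "has_mono_AP k n (coloring_of f)"
  then obtain a d c where ad: "a > 0" "d > 0" and sub: "(\<lambda>i. a + i * d) ` {0..<k} \<subseteq> {1..n}"
    and c: "\<forall>x\<in>(\<lambda>i. a + i * d) ` {0..<k}. coloring_of f x = c"
    unfolding has_mono_AP_def is_AP_def monochromatic_def by auto
  have "a + (k - 1) * d \<in> {1..n}" using sub assms by (auto simp: image_subset_iff)
  then have le: "a + (k - 1) * d \<le> n" by simp
  have "1 * d \<le> (k - 1) * d" using assms by (intro mult_right_mono) auto
  with le have "d \<le> n" "a \<le> n" by linarith+
  with ad have "d \<in> {1..n}" "a \<in> {1..n}" by auto
  moreover have "mono_at k f a d"
    unfolding mono_at_def
  proof (intro exI[of _ "c = 1"] allI impI)
    fix i assume "i < k"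
    then have "coloring_of f (a + i * d) = c" using c by simp
    then show "f (a + i * d) = (c = 1)" by (cases "f (a + i * d)") auto
  qed
  ultimately show "\<exists>d\<in>{1..n}. \<exists>a\<in>{1..n}. a + (k - 1) * d \<le> n \<and> mono_at k f a d"
    using le by blast
next
  assume "\<exists>d\<in>{1..n}. \<exists>a\<in>{1..n}. a + (k - 1) * d \<le> n \<and> mono_at k f a d"
  then obtain a d b where ad: "a \<ge> 1" "d \<ge> 1" and le: "a + (k - 1) * d \<le> n"
    and b: "\<And>i. i < k \<Longrightarrow> f (a + i * d) = b"
    unfolding mono_at_def by (auto simp: Suc_le_eq)
  have "a + i * d \<le> n" if "i < k" for i
  proof -
    have "i * d \<le> (k - 1) * d" using that by (intro mult_right_mono) auto
    with le show ?thesis by linarith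
  qed
  moreover have "is_AP k ((\<lambda>i. a + i * d) ` {0..<k})"
    unfolding is_AP_def using ad by (metis less_eq_Suc_le One_nat_def)
  ultimately show "has_mono_AP k n (coloring_of f)"
    unfolding has_mono_AP_def monochromatic_def using ad b
    by (intro exI[of _ "(\<lambda>i. a + i * d) ` {0..<k}"]) auto
qed

lemma no_mono_AP_0: "k \<ge> 1 \<Longrightarrow> \<not> has_mono_AP k 0 COL"
  unfolding has_mono_AP_def is_AP_def by auto

lemma two_coloring_coloring_of: "two_coloring n (coloring_of f)"
  unfolding two_coloring_def by auto

section \<open>Probability that a random coloring is proper\<close>

text \<open>The event is a product set: each coordinate in \<open>S\<close> contributes the factor
  \<open>1 / 2\<close>, every other one the factor 1.\<close>

lemma prob_coins_constant_on:
  assumes "S \<subseteq> {1..n}"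
  shows "measure_pmf.prob (coins n) {f. \<forall>x\<in>S. f x = b} = (1 / 2) ^ card S"
proof -
  have "{f. \<forall>x\<in>S. f x = b} = Pi {1..n} (\<lambda>x. if x \<in> S then {b} else UNIV)"
    using assms by (auto simp: Pi_iff split: if_splits)
  then have "measure_pmf.prob (coins n) {f. \<forall>x\<in>S. f x = b} =
      (\<Prod>x\<in>{1..n}. measure_pmf.prob (bernoulli_pmf (1 / 2)) (if x \<in> S then {b} else UNIV))"
    by (simp add: measure_Pi_pmf_Pi)
  also have "\<dots> = (\<Prod>x\<in>{1..n}. if x \<in> S then 1 / 2 else 1)"
    by (intro prod.cong) (cases b; auto simp: measure_pmf_single)+
  also have "\<dots> = (\<Prod>x\<in>S. 1 / 2)"
    using assms by (intro prod.mono_neutral_cong_right) auto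
  finally show ?thesis by simp
qed

text \<open>As \<open>d > 0\<close>, the \<open>k\<close> terms are distinct. The bound adds up the
  probabilities for the two colors.\<close>

lemma prob_coins_mono_at:
  assumes "k \<ge> 1" "d > 0" "a > 0" "a + (k - 1) * d \<le> n"
  shows "measure_pmf.prob (coins n) {f. mono_at k f a d} \<le> 2 / 2 ^ k"
proof -
  let ?S = "(\<lambda>i. a + i * d) ` {..<k}"
  have sub: "?S \<subseteq> {1..n}"
  proof
    fix x assume "x \<in> ?S"
    then obtain i where i: "i < k" "x = a + i * d" by auto
    then have "i * d \<le> (k - 1) * d" by (intro mult_right_mono) auto
    with i assms(4) have "x \<le> n" by linarith
    with i assms show "x \<in> {1..n}" by simp
  qed
  have card: "card ?S = k"
    using assms(2) by (subst card_image) (auto simp: inj_on_def)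
  have "{f. mono_at k f a d} \<subseteq> {f. \<forall>x\<in>?S. f x = True} \<union> {f. \<forall>x\<in>?S. f x = False}"
    unfolding mono_at_def by auto
  then have "measure_pmf.prob (coins n) {f. mono_at k f a d}
      \<le> measure_pmf.prob (coins n) ({f. \<forall>x\<in>?S. f x = True} \<union> {f. \<forall>x\<in>?S. f x = False})"
    by (intro measure_pmf.finite_measure_mono) auto
  also have "\<dots> \<le> measure_pmf.prob (coins n) {f. \<forall>x\<in>?S. f x = True} +
      measure_pmf.prob (coins n) {f. \<forall>x\<in>?S. f x = False}"
    by (intro measure_Un_le) auto
  also have "\<dots> = (1 / 2) ^ k + (1 / 2) ^ k"
    unfolding prob_coins_constant_on[OF sub] card ..
  finally show ?thesis by (simp add: power_divide)
qed

lemma finite_progressions: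
  fixes k n :: nat
  assumes "k \<ge> 1"
  shows "finite {(d, a). d \<ge> 1 \<and> a \<ge> 1 \<and> a + k * d \<le> n}"
proof (rule finite_subset)
  have "d \<le> n \<and> a \<le> n" if "a + k * d \<le> n" for d a
  proof -
    have "1 * d \<le> k * d" using assms by (intro mult_right_mono) auto
    with that show ?thesis by linarith
  qed
  then show "{(d, a). d \<ge> 1 \<and> a \<ge> 1 \<and> a + k * d \<le> n} \<subseteq> {..n} \<times> {..n}"
    by blast
qed simp

text \<open>Here \<open>k\<close> is the number of gaps, one less than the number of terms. Exactly
  \<open>n - k\<close> progressions have difference 1. Lowering a larger difference by 1 brings the
  last term down by \<open>k\<close>, which leads to the count for \<open>n - k\<close>. With
  \<open>m = n - k\<close> the recursion closes because
  \<open>2 * k * m + m\<^sup>2 \<le> (m + k)\<^sup>2\<close>.\<close>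

lemma card_progressions_le:
  fixes k n :: nat
  assumes "k \<ge> 1"
  shows "2 * k * card {(d, a). d \<ge> 1 \<and> a \<ge> 1 \<and> a + k * d \<le> n} \<le> n\<^sup>2"
proof (induction n rule: less_induct)
  case (less n)
  let ?P = "\<lambda>n. {(d, a). d \<ge> 1 \<and> a \<ge> 1 \<and> a + k * d \<le> n}"
  show ?case
  proof (cases "n \<le> k")
    case True
    have "n < a + k * d" if "d \<ge> 1" "a \<ge> 1" for d a
    proof -
      have "k \<le> k * d" using that by simp
      with that True show ?thesis by linarith
    qed
    then have empty: "?P n = {}" by (auto simp: not_le[symmetric])
    show ?thesis unfolding empty by simp
  next
    case False
    define m where "m = n - k"
    have n: "n = m + k" and "m < n" using False assms by (auto simp: m_def)
    have fin: "finite (?P m)" using assms by (rule finite_progressions)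
    have "?P n = (\<lambda>a. (1, a)) ` {1..m} \<union> (\<lambda>(d, a). (Suc d, a)) ` ?P m"
    proof (intro set_eqI iffI)
      fix x assume "x \<in> ?P n"
      then obtain d a where x: "x = (d, a)" "d \<ge> 1" "a \<ge> 1" "a + k * d \<le> n" by auto
      show "x \<in> (\<lambda>a. (1, a)) ` {1..m} \<union> (\<lambda>(d, a). (Suc d, a)) ` ?P m"
      proof (cases "d = 1")
        case True
        then show ?thesis using x n by auto
      next
        case False
        then obtain e where e: "d = Suc e" "e \<ge> 1" using x(2) by (cases d) auto
        then have "(e, a) \<in> ?P m" using x n by (auto simp: algebra_simps)
        then have "(\<lambda>(d, a). (Suc d, a)) (e, a) \<in> (\<lambda>(d, a). (Suc d, a)) ` ?P m" by (rule imageI)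
        then show ?thesis using e x(1) by simp
      qed
    qed (auto simp: n)
    then have "card (?P n) \<le> card ((\<lambda>a. (1::nat, a)) ` {1..m}) + card ((\<lambda>(d, a). (Suc d, a)) ` ?P m)"
      by (simp only: card_Un_le)
    also have "\<dots> \<le> m + card (?P m)"
      using card_image_le[OF fin, of "\<lambda>(d, a). (Suc d, a)"] card_image_le[of "{1..m}" "\<lambda>a. (1::nat, a)"]
      by simp
    finally have "2 * k * card (?P n) \<le> 2 * k * (m + card (?P m))"
      by (intro mult_left_mono) simp_all
    also have "\<dots> = 2 * k * m + 2 * k * card (?P m)" by (rule add_mult_distrib2)
    also have "\<dots> \<le> 2 * k * m + m\<^sup>2" using less.IH[OF \<open>m < n\<close>] by simp
    also have "\<dots> \<le> n\<^sup>2" by (simp add: n power2_eq_square algebra_simps)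
    finally show ?thesis .
  qed
qed

lemma prob_proper_coloring:
  assumes k: "k \<ge> 1" and n: "3 * n\<^sup>2 \<le> k * 2 ^ (k - 1)"
  shows "measure_pmf.prob (coins n) {f. proper_coloring k n (coloring_of f)} \<ge> 2 / 3"
\<comment> \<open>The count of progressions needs at least one gap. For \<open>k = 1\<close> the
  size condition forces \<open>n = 0\<close>.\<close>
proof (cases "k = 1")
  case True
  with n have "3 * n\<^sup>2 \<le> 1" by simp
  then have "n\<^sup>2 = 0" by linarith
  then have "n = 0" by simp
  then have "{f. proper_coloring k n (coloring_of f)} = UNIV"
    using no_mono_AP_0 k two_coloring_coloring_of unfolding proper_coloring_def by auto
  then show ?thesis by simp
next
  case False
  with k have k2: "k \<ge> 2" by simp
  let ?A = "{(d, a). d \<ge> 1 \<and> a \<ge> 1 \<and> a + (k - 1) * d \<le> n}"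
  let ?bad = "\<Union>(d, a)\<in>?A. {f. mono_at k f a d}"
  have fin: "finite ?A" using k2 by (intro finite_progressions) simp
  have "- {f. proper_coloring k n (coloring_of f)} \<subseteq> ?bad"
    unfolding proper_coloring_def has_mono_AP_coloring_of_iff[OF k2]
    using two_coloring_coloring_of by auto
  then have "measure_pmf.prob (coins n) (- {f. proper_coloring k n (coloring_of f)})
      \<le> measure_pmf.prob (coins n) ?bad"
    by (intro measure_pmf.finite_measure_mono) auto
  also have "\<dots> \<le> (\<Sum>x\<in>?A. measure_pmf.prob (coins n) (case x of (d, a) \<Rightarrow> {f. mono_at k f a d}))"
    by (intro measure_pmf.finite_measure_subadditive_finite fin) auto
  also have "\<dots> \<le> (\<Sum>x\<in>?A. 2 / 2 ^ k)"
    using prob_coins_mono_at[OF k] by (intro sum_mono) auto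
  also have "\<dots> = card ?A * (2 / 2 ^ k)" by simp
  also have "\<dots> \<le> 1 / 3"
  proof -
    have "2 * (k - 1) * card ?A \<le> n\<^sup>2" using k2 by (intro card_progressions_le) simp
    then have "3 * (2 * (k - 1) * card ?A) \<le> k * 2 ^ (k - 1)" using n by linarith
    \<comment> \<open>For \<open>k \<ge> 2\<close> the factor \<open>k\<close> is at most
      \<open>2 * (k - 1)\<close>, which then cancels and leaves
      \<open>3 * card ?A \<le> 2 ^ (k - 1)\<close>.\<close>
    also have "\<dots> \<le> 2 * (k - 1) * 2 ^ (k - 1)" using k2 by (intro mult_right_mono) auto
    finally have "2 * (k - 1) * (3 * card ?A) \<le> 2 * (k - 1) * 2 ^ (k - 1)" by (simp add: ac_simps)
    then have "3 * card ?A \<le> 2 ^ (k - 1)" using k2 by simp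
    then have "real (3 * card ?A) \<le> real (2 ^ (k - 1))" by (simp only: of_nat_le_iff)
    moreover have "(2::real) ^ k = 2 * 2 ^ (k - 1)" using k by (cases k) auto
    ultimately show ?thesis by (simp add: field_simps)
  qed
  finally have "measure_pmf.prob (coins n) (- {f. proper_coloring k n (coloring_of f)}) \<le> 1 / 3" .
  moreover have "measure_pmf.prob (coins n) {f. proper_coloring k n (coloring_of f)} =
      1 - measure_pmf.prob (coins n) (- {f. proper_coloring k n (coloring_of f)})"
    using measure_pmf.prob_compl[of "- {f. proper_coloring k n (coloring_of f)}" "coins n"]
    by (simp add: Compl_eq_Diff_UNIV double_diff)
  ultimately show ?thesis by linarith
qed

section \<open>The search program\<close>

text \<open>
  Registers: 0 holds \<open>k\<close>, 1 the constant 1, 2 the constant 20, 3 the number \<open>k 2 ^ (k - 1)\<close>, 4 a loop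
  counter, 5 the number \<open>n\<close>, 9 the constant 0 (so that \<open>JumpZero 9 l\<close> is an unconditional jump), 10 is
  scratch space, 11 holds \<open>n + 20\<close>, 12 an address.  Cell \<open>20 + x\<close> holds the color of \<open>x\<close>.
  While \<open>n\<close> is incremented from \<open>m\<close>, registers 6, 7 and 8 hold \<open>3 (m + 1)\<^sup>2\<close>, its increment
  \<open>6 m + 9\<close>, and 6.  In the test of a progression with difference \<open>d\<close> (register 13) and start \<open>a\<close>
  (register 14), register 15 holds the sum of its colors, which is 0 or \<open>k\<close> iff it is monochromatic,
  and register 16 holds \<open>n + 20 + d\<close>: the final address \<open>20 + a + k d\<close> is compared with it, so cells
  beyond the coloring may be read, but then the sum is ignored.

  Computation of \<open>n\<close>: 0--19; coin flips: 20--25; tests: 26--49; output of the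
  coloring: 50--58; failure: 59.
\<close>

definition search_program :: program where
  "search_program = [
    Const 1 1,
    Const 2 20,
    Sub 4 0 1,
    Add 3 0 9,
    JumpZero 4 8,
    Add 3 3 3,
    Sub 4 4 1,
    JumpZero 9 4,
    Const 6 3,
    Const 7 9,
    Const 8 6,
    Sub 10 6 3,
    JumpZero 10 14,
    JumpZero 9 18,
    Add 5 5 1,
    Add 6 6 7,
    Add 7 7 8,
    JumpZero 9 11,
    Add 11 5 2,
    Add 12 11 9,
    Sub 10 12 2,
    JumpZero 10 26,
    Flip 10,
    Store 12 10,
    Sub 12 12 1,
    JumpZero 9 20,
    Add 13 5 9,
    JumpZero 13 50,
    Add 14 5 9,
    Add 16 11 13,
    JumpZero 14 48,
    Add 12 14 2,
    Const 15 0,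
    Add 4 0 9,
    JumpZero 4 40,
    Load 10 12,
    Add 15 15 10,
    Add 12 12 13,
    Sub 4 4 1,
    JumpZero 9 34,
    Sub 10 12 16,
    JumpZero 10 43,
    JumpZero 9 46,
    JumpZero 15 59,
    Sub 10 0 15,
    JumpZero 10 59,
    Sub 14 14 1,
    JumpZero 9 30,
    Sub 13 13 1,
    JumpZero 9 27,
    Print 1,
    Add 12 2 1,
    Add 4 5 9,
    JumpZero 4 60,
    Load 10 12,
    Print 10,
    Add 12 12 1,
    Sub 4 4 1,
    JumpZero 9 53,
    Print 9]"

abbreviation config_at :: "nat \<Rightarrow> (nat \<Rightarrow> nat) \<Rightarrow> nat list \<Rightarrow> config" where
  "config_at l R w \<equiv> \<lparr>pc = l, reg = R, tape = w\<rparr>"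

section \<open>Composition and symbolic execution of runs\<close>

lemma run_add: "run P (s + t) c = bind_pmf (run P s c) (run P t)"
  by (induction s arbitrary: c) (auto simp: bind_return_pmf bind_assoc_pmf intro!: bind_pmf_cong)

lemma run_trans:
  assumes "run P s c = return_pmf c'"
  shows "run P (s + t) c = run P t c'"
  by (simp add: run_add assms bind_return_pmf)

lemma run_halted: "halted P c \<Longrightarrow> run P t c = return_pmf c"
  by (induction t) (simp_all add: step_def bind_return_pmf)

lemma run_halted_mono:
  assumes "run P s c = return_pmf c'" "halted P c'" "s \<le> t"
  shows "run P t c = return_pmf c'"
  using run_trans[OF assms(1), of "t - s"] run_halted[OF assms(2)] assms(3) by simp

lemma run_numeral:
  "run P (numeral v) c = bind_pmf (step P c) (run P (pred_numeral v))"
  by (simp add: numeral_eq_Suc)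

lemma halted_search_program: "halted search_program c \<longleftrightarrow> pc c \<ge> 60"
  by (simp add: halted_def search_program_def eval_nat_numeral)

lemma step_search_program:
  "l < 60 \<Longrightarrow> step search_program (config_at l R w) = exec_instr (search_program ! l) (config_at l R w)"
  by (simp add: step_def halted_search_program)

lemmas nth_search_program = fun_cong[OF arg_cong[OF search_program_def, of nth]]

text \<open>Rewriting with these rules executes a numeral number of steps from a known program
  counter. The loops are added by induction.\<close>

lemmas exec_simps =
  run_numeral step_search_program nth_search_program set_reg_def bind_return_pmf

text \<open>Frame condition: \<open>X\<close> lists the registers that a phase may have
  changed.\<close>

definition agree_off :: "nat set \<Rightarrow> (nat \<Rightarrow> nat) \<Rightarrow> (nat \<Rightarrow> nat) \<Rightarrow> bool" where
  "agree_off X R R' \<longleftrightarrow> (\<forall>x. x \<notin> X \<longrightarrow> R' x = R x)"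

lemma agree_off_refl: "agree_off X R R"
  by (simp add: agree_off_def)

lemma agree_off_trans: "agree_off X R R' \<Longrightarrow> agree_off X R' R'' \<Longrightarrow> agree_off X R R''"
  by (simp add: agree_off_def)

lemma agree_off_mono: "agree_off X R R' \<Longrightarrow> X \<subseteq> Y \<Longrightarrow> agree_off Y R R'"
  by (auto simp: agree_off_def)

lemma agree_off_upd: "x \<in> X \<Longrightarrow> agree_off X (R(x := v)) R' \<longleftrightarrow> agree_off X R R'"
  by (auto simp: agree_off_def)

lemma agree_offD: "agree_off X R R' \<Longrightarrow> x \<notin> X \<Longrightarrow> R' x = R x"
  by (simp add: agree_off_def)

section \<open>Computation of \<open>n\<close>\<close>

text \<open>Four instructions for each doubling and one exit jump give the exact number of steps, as
  needed for chaining phases by \<open>run_trans\<close>.\<close>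

lemma doubling_loop:
  assumes "R 1 = 1" "R 9 = 0" "R 4 = i"
  shows "\<exists>R'. run search_program (4 * i + 1) (config_at 4 R w) = return_pmf (config_at 8 R' w)
    \<and> agree_off {3, 4} R R' \<and> R' 3 = R 3 * 2 ^ i"
  using assms
proof (induction i arbitrary: R)
  case 0
  then have "run search_program (4 * 0 + 1) (config_at 4 R w) = return_pmf (config_at 8 R w)"
    by (simp add: exec_simps)
  then show ?case using agree_off_refl by fastforce
next
  case (Suc i)
  let ?R = "R(3 := R 3 + R 3, 4 := i)"
  have 1: "run search_program 4 (config_at 4 R w) = return_pmf (config_at 4 ?R w)"
    using Suc.prems by (simp add: exec_simps)
  have "?R 1 = 1" "?R 9 = 0" "?R 4 = i" using Suc.prems by simp_all
  from Suc.IH[OF this] obtain R' where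
    2: "run search_program (4 * i + 1) (config_at 4 ?R w) = return_pmf (config_at 8 R' w)"
    and R': "agree_off {3, 4} ?R R'" "R' 3 = ?R 3 * 2 ^ i" by blast
  have "run search_program (4 + (4 * i + 1)) (config_at 4 R w) = return_pmf (config_at 8 R' w)"
    unfolding run_trans[OF 1] by (rule 2)
  moreover have "4 + (4 * i + 1) = 4 * Suc i + 1" by simp
  moreover have "agree_off {3, 4} R R'" using R'(1) by (simp add: agree_off_upd)
  moreover have "R' 3 = R 3 * 2 ^ Suc i" using R'(2) by simp
  ultimately show ?case by metis
qed

text \<open>The assumptions are the loop invariant, with \<open>m\<close> the current candidate and
  \<open>j\<close> the number of increments still to come. Truncated subtraction of register 3 from
  register 6 gives 0 iff \<open>m + 1\<close> still satisfies the size condition.\<close>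

lemma root_loop:
  assumes "R 1 = 1" "R 9 = 0" "R 8 = 6" "R 5 = m" "R 6 = 3 * (m + 1)\<^sup>2" "R 7 = 6 * m + 9"
    and "n = m + j" "3 * n\<^sup>2 \<le> R 3" "R 3 < 3 * (n + 1)\<^sup>2"
  shows "\<exists>R'. run search_program (6 * j + 3) (config_at 11 R w) = return_pmf (config_at 18 R' w)
    \<and> agree_off {5, 6, 7, 10} R R' \<and> R' 5 = n"
  using assms
proof (induction j arbitrary: R m)
  case 0
  then have "R 6 - R 3 \<noteq> 0" by simp
  then have "run search_program (6 * 0 + 3) (config_at 11 R w) =
      return_pmf (config_at 18 (R(10 := R 6 - R 3)) w)"
    using 0(2) by (simp add: exec_simps)
  moreover have "agree_off {5, 6, 7, 10} R (R(10 := R 6 - R 3))" by (simp add: agree_off_def)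
  moreover have "(R(10 := R 6 - R 3)) 5 = n" using 0 by simp
  ultimately show ?case by blast
next
  case (Suc j)
  let ?R = "R(10 := 0, 5 := Suc m, 6 := R 6 + R 7, 7 := R 7 + 6)"
  have "3 * (m + 1)\<^sup>2 \<le> 3 * n\<^sup>2"
    using Suc.prems(7) by (intro mult_left_mono power_mono) auto
  then have "R 6 - R 3 = 0" using Suc.prems(5,8) by linarith
  then have 1: "run search_program 6 (config_at 11 R w) = return_pmf (config_at 11 ?R w)"
    using Suc.prems(1-4) by (simp add: exec_simps)
  have "?R 1 = 1" "?R 9 = 0" "?R 8 = 6" "?R 5 = Suc m" "?R 7 = 6 * Suc m + 9"
    "n = Suc m + j" "3 * n\<^sup>2 \<le> ?R 3" "?R 3 < 3 * (n + 1)\<^sup>2"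
    using Suc.prems by simp_all
  \<comment> \<open>The difference between \<open>3 * (m + 2)\<^sup>2\<close> and
    \<open>3 * (m + 1)\<^sup>2\<close> is \<open>6 * m + 9\<close>, the content of register
    7.\<close>
  moreover have "?R 6 = 3 * (Suc m + 1)\<^sup>2"
    using Suc.prems(5,6) by (simp add: power2_eq_square algebra_simps)
  ultimately obtain R' where
    2: "run search_program (6 * j + 3) (config_at 11 ?R w) = return_pmf (config_at 18 R' w)"
    and R': "agree_off {5, 6, 7, 10} ?R R'" "R' 5 = n" using Suc.IH[of ?R "Suc m"] by blast
  have "run search_program (6 + (6 * j + 3)) (config_at 11 R w) = return_pmf (config_at 18 R' w)"
    unfolding run_trans[OF 1] by (rule 2)
  moreover have "6 + (6 * j + 3) = 6 * Suc j + 3" by simp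
  moreover have "agree_off {5, 6, 7, 10} R R'" using R'(1) by (simp add: agree_off_upd)
  ultimately show ?case using R'(2) by metis
qed

lemma run_arithmetic_phase:
  assumes k: "k \<ge> 1" and n: "3 * n\<^sup>2 \<le> k * 2 ^ (k - 1)" "k * 2 ^ (k - 1) < 3 * (n + 1)\<^sup>2"
  shows "\<exists>R. run search_program (4 * (k - 1) + 6 * n + 13) (initial k) = return_pmf (config_at 20 R [])
    \<and> R 0 = k \<and> R 1 = 1 \<and> R 2 = 20 \<and> R 5 = n \<and> R 9 = 0 \<and> R 11 = n + 20 \<and> R 12 = n + 20"
proof -
  let ?R0 = "(\<lambda>_. 0)(0 := k, 1 := 1, 2 := 20, 4 := k - 1, 3 := k)"
  have 0: "run search_program 4 (initial k) = return_pmf (config_at 4 ?R0 [])"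
    unfolding initial_def by (simp add: exec_simps)
  obtain R1 where
    1: "run search_program (4 * (k - 1) + 1) (config_at 4 ?R0 []) = return_pmf (config_at 8 R1 [])"
    and "agree_off {3, 4} ?R0 R1" and x: "R1 3 = k * 2 ^ (k - 1)"
    using doubling_loop[of ?R0 "k - 1" "[]"] by auto
  then have R1: "R1 0 = k" "R1 1 = 1" "R1 2 = 20" "R1 5 = 0" "R1 9 = 0"
    by (auto dest!: agree_offD[of _ _ _ 0] simp: agree_off_def)
  \<comment> \<open>These constants establish the invariant of \<open>root_loop\<close> for
    \<open>m = 0\<close>.\<close>
  let ?R2 = "R1(6 := 3, 7 := 9, 8 := 6)"
  have 2: "run search_program 3 (config_at 8 R1 []) = return_pmf (config_at 11 ?R2 [])"
    by (simp add: exec_simps)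
  obtain R3 where
    3: "run search_program (6 * n + 3) (config_at 11 ?R2 []) = return_pmf (config_at 18 R3 [])"
    and a3: "agree_off {5, 6, 7, 10} ?R2 R3" and n3: "R3 5 = n"
    using root_loop[of ?R2 0 n n "[]"] R1 x n by auto
  from a3 R1 have R3: "R3 0 = k" "R3 1 = 1" "R3 2 = 20" "R3 9 = 0"
    by (auto simp: agree_off_def)
  let ?R4 = "R3(11 := n + 20, 12 := n + 20)"
  have 4: "run search_program 2 (config_at 18 R3 []) = return_pmf (config_at 20 ?R4 [])"
    using R3 n3 by (simp add: exec_simps)
  have "run search_program (4 + ((4 * (k - 1) + 1) + (3 + ((6 * n + 3) + 2)))) (initial k) =
      return_pmf (config_at 20 ?R4 [])"
    unfolding run_trans[OF 0] run_trans[OF 1] run_trans[OF 2] run_trans[OF 3] by (rule 4)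
  moreover have "4 + ((4 * (k - 1) + 1) + (3 + ((6 * n + 3) + 2))) = 4 * (k - 1) + 6 * n + 13"
    by simp
  ultimately have "run search_program (4 * (k - 1) + 6 * n + 13) (initial k) =
      return_pmf (config_at 20 ?R4 [])" by metis
  then show ?thesis using R3 n3 by (intro exI[of _ ?R4]) simp
qed

section \<open>Coin flips\<close>

text \<open>Register 10 does not keep the last coin: the comparison that ends the loop overwrites it
  with 0, when the address in register 12 has come down to 20.\<close>

definition with_coins :: "nat \<Rightarrow> (nat \<Rightarrow> bool) \<Rightarrow> (nat \<Rightarrow> nat) \<Rightarrow> nat \<Rightarrow> nat" where
  "with_coins i f R = (\<lambda>r. if 20 < r \<and> r \<le> 20 + i then of_bool (f (r - 20)) else (R(10 := 0, 12 := 20)) r)"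

text \<open>Cells are filled from the top, so the first iteration colors the largest number. The
  induction conditions on this flip and rejoins it with the remaining independent ones by
  \<open>Pi_pmf_insert'\<close>.\<close>

lemma coin_loop:
  assumes "R 1 = 1" "R 2 = 20" "R 9 = 0" "R 12 = i + 20"
  shows "run search_program (6 * i + 2) (config_at 20 R w) =
    map_pmf (\<lambda>f. config_at 26 (with_coins i f R) w) (coins i)"
  using assms
proof (induction i arbitrary: R)
  case 0
  have "with_coins 0 f R = R(10 := 0)" for f
    using 0 by (auto simp: with_coins_def fun_eq_iff)
  then show ?case using 0 by (simp add: exec_simps map_pmf_const fun_upd_def)
next
  case (Suc i)
  define S where "S b = R(10 := of_bool b, 21 + i := of_bool b, 12 := 20 + i)" for b :: bool
  have "run search_program 6 (config_at 20 R w) =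
      bind_pmf (bernoulli_pmf (1 / 2)) (\<lambda>b. return_pmf (config_at 20 (S b) w))"
    using Suc.prems by (simp add: exec_simps S_def map_pmf_def bind_assoc_pmf)
  then have "run search_program (6 + (6 * i + 2)) (config_at 20 R w) =
      bind_pmf (bernoulli_pmf (1 / 2)) (\<lambda>b. run search_program (6 * i + 2) (config_at 20 (S b) w))"
    unfolding run_add[of _ 6] by (simp only: bind_assoc_pmf bind_return_pmf)
  also have "\<dots> = bind_pmf (bernoulli_pmf (1 / 2)) (\<lambda>b.
      map_pmf (\<lambda>f. config_at 26 (with_coins i f (S b)) w) (coins i))"
    using Suc.prems by (intro bind_pmf_cong refl Suc.IH) (simp_all add: S_def)
  also have "\<dots> = bind_pmf (bernoulli_pmf (1 / 2)) (\<lambda>b.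
      map_pmf (\<lambda>f. config_at 26 (with_coins (Suc i) (f(Suc i := b)) R) w) (coins i))"
  proof (intro bind_pmf_cong refl map_pmf_cong)
    fix b f
    have "with_coins i f (S b) = with_coins (Suc i) (f(Suc i := b)) R"
      by (auto simp: with_coins_def S_def fun_eq_iff)
    then show "config_at 26 (with_coins i f (S b)) w =
        config_at 26 (with_coins (Suc i) (f(Suc i := b)) R) w" by simp
  qed
  also have "\<dots> = map_pmf (\<lambda>f. config_at 26 (with_coins (Suc i) f R) w)
      (Pi_pmf (insert (Suc i) {1..i}) False (\<lambda>_. bernoulli_pmf (1 / 2)))"
    by (subst Pi_pmf_insert') (simp_all add: bind_assoc_pmf bind_return_pmf map_pmf_def)
  also have "insert (Suc i) {1..i} = {1..Suc i}" by auto
  also have "6 + (6 * i + 2) = 6 * Suc i + 2" by simp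
  finally show ?case .
qed

section \<open>Tests of all progressions\<close>

text \<open>The invariant of the tests, which write only to the scratch registers listed in
  \<open>stores_agree_off\<close>.\<close>

definition stores :: "nat \<Rightarrow> nat \<Rightarrow> (nat \<Rightarrow> bool) \<Rightarrow> (nat \<Rightarrow> nat) \<Rightarrow> bool" where
  "stores k n f R \<longleftrightarrow> R 0 = k \<and> R 1 = 1 \<and> R 2 = 20 \<and> R 5 = n \<and> R 9 = 0 \<and> R 11 = n + 20 \<and>
     (\<forall>x\<in>{1..n}. R (20 + x) = of_bool (f x))"

lemma stores_agree_off:
  assumes "stores k n f R" "agree_off X R R'" "X \<subseteq> {4, 10, 12, 13, 14, 15, 16}"
  shows "stores k n f R'"
proof -
  have "R' x = R x" if "x \<notin> {4, 10, 12, 13, 14, 15, 16}" for x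
    using assms(2,3) that by (auto simp: agree_off_def)
  then show ?thesis using assms(1) by (simp add: stores_def)
qed

text \<open>Addresses start above 20 and never decrease, so the loop reads no register that it
  changes and the sum can be stated with the initial \<open>R\<close>.\<close>

lemma sum_loop:
  assumes "R 1 = 1" "R 9 = 0" "R 4 = i" "R 12 > 20"
  shows "\<exists>R'. run search_program (6 * i + 1) (config_at 34 R w) = return_pmf (config_at 40 R' w)
    \<and> agree_off {4, 10, 12, 15} R R' \<and> R' 12 = R 12 + i * R 13
    \<and> R' 15 = R 15 + (\<Sum>j<i. R (R 12 + j * R 13))"
  using assms
proof (induction i arbitrary: R)
  case 0
  then have "run search_program (6 * 0 + 1) (config_at 34 R w) = return_pmf (config_at 40 R w)"
    by (simp add: exec_simps)
  then show ?case using agree_off_refl by fastforce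
next
  case (Suc i)
  let ?R = "R(10 := R (R 12), 15 := R 15 + R (R 12), 12 := R 12 + R 13, 4 := i)"
  have 1: "run search_program 6 (config_at 34 R w) = return_pmf (config_at 34 ?R w)"
    using Suc.prems by (simp add: exec_simps)
  have "?R 1 = 1" "?R 9 = 0" "?R 4 = i" "?R 12 > 20" using Suc.prems by simp_all
  from Suc.IH[OF this] obtain R' where
    2: "run search_program (6 * i + 1) (config_at 34 ?R w) = return_pmf (config_at 40 R' w)"
    and R': "agree_off {4, 10, 12, 15} ?R R'" "R' 12 = ?R 12 + i * ?R 13"
      "R' 15 = ?R 15 + (\<Sum>j<i. ?R (?R 12 + j * ?R 13))" by blast
  have "run search_program (6 + (6 * i + 1)) (config_at 34 R w) = return_pmf (config_at 40 R' w)"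
    unfolding run_trans[OF 1] by (rule 2)
  moreover have "6 + (6 * i + 1) = 6 * Suc i + 1" by simp
  moreover have "agree_off {4, 10, 12, 15} R R'" using R'(1) by (simp add: agree_off_upd)
  moreover have "R' 12 = R 12 + Suc i * R 13" using R'(2) by simp
  moreover have "R' 15 = R 15 + (\<Sum>j<Suc i. R (R 12 + j * R 13))"
  proof -
    have "(\<Sum>j<i. ?R (?R 12 + j * ?R 13)) = (\<Sum>j<i. R (R 12 + Suc j * R 13))"
      using Suc.prems(4) by (intro sum.cong) (auto simp: add.assoc)
    then have "R' 15 = R 15 + (R (R 12) + (\<Sum>j<i. R (R 12 + Suc j * R 13)))"
      unfolding R'(3) by (simp only: fun_upd_apply) simp
    moreover have "(\<Sum>j<Suc i. R (R 12 + j * R 13)) = R (R 12) + (\<Sum>j<i. R (R 12 + Suc j * R 13))"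
      by (simp add: sum.lessThan_Suc_shift del: sum.lessThan_Suc)
    ultimately show ?thesis by metis
  qed
  ultimately show ?case by metis
qed

text \<open>The sum counts the terms of color 1: there are none of them or all
  \<open>k\<close>.\<close>

lemma mono_at_iff_sum:
  "mono_at k f a d \<longleftrightarrow> (\<Sum>j<k. of_bool (f (a + j * d))) = (0::nat)
     \<or> (\<Sum>j<k. of_bool (f (a + j * d))) = k"
proof -
  let ?A = "{j. j < k \<and> f (a + j * d)}"
  have "(\<Sum>j<k. of_bool (f (a + j * d))) = (\<Sum>j<k. if f (a + j * d) then 1 else 0 :: nat)"
    by (simp only: of_bool_def)
  also have "\<dots> = (\<Sum>j | j \<in> {..<k} \<and> f (a + j * d). 1)"
    by (rule sum.inter_filter[symmetric]) simp
  finally have sum: "(\<Sum>j<k. of_bool (f (a + j * d))) = card ?A"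
    by simp
  have sub: "?A \<subseteq> {..<k}" by auto
  have full: "card ?A = k \<longleftrightarrow> ?A = {..<k}"
  proof
    assume "card ?A = k"
    then show "?A = {..<k}"
      using card_subset_eq[OF finite_lessThan sub] by (simp only: card_lessThan)
  qed (simp only: card_lessThan)
  have empty: "card ?A = 0 \<longleftrightarrow> ?A = {}"
    using finite_subset[OF sub finite_lessThan] by (rule card_0_eq)
  have "mono_at k f a d \<longleftrightarrow> (\<forall>j<k. f (a + j * d)) \<or> (\<forall>j<k. \<not> f (a + j * d))"
    unfolding mono_at_def ex_bool_eq by (simp only: simp_thms)
  also have "(\<forall>j<k. f (a + j * d)) \<longleftrightarrow> ?A = {..<k}" using sub by fastforce
  also have "(\<forall>j<k. \<not> f (a + j * d)) \<longleftrightarrow> ?A = {}" by simp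
  finally show ?thesis unfolding sum full empty by (simp only: disj_commute)
qed

text \<open>The range condition is included because the machine also visits pairs whose progression
  leaves \<open>{1..n}\<close>.\<close>

definition bad_at :: "nat \<Rightarrow> nat \<Rightarrow> (nat \<Rightarrow> bool) \<Rightarrow> nat \<Rightarrow> nat \<Rightarrow> bool" where
  "bad_at k n f d a \<longleftrightarrow> a + (k - 1) * d \<le> n \<and> mono_at k f a d"

text \<open>The time depends on the branch taken and is only bounded: 4 steps of preparation,
  \<open>6 * k + 1\<close> for the sum, and at most 7 for the decision. Instruction 59 is the
  failure exit, instruction 30 the next start.\<close>

lemma check_progression:
  assumes k: "k \<ge> 1" and R: "stores k n f R" "R 13 = d" "R 16 = n + 20 + d" "R 14 = Suc a"
  shows "\<exists>t R'. t \<le> 6 * k + 14 \<and>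
    run search_program t (config_at 30 R w) =
      return_pmf (config_at (if bad_at k n f d (Suc a) then 59 else 30) R' w) \<and>
    agree_off {4, 10, 12, 14, 15} R R' \<and> (\<not> bad_at k n f d (Suc a) \<longrightarrow> R' 14 = a)"
proof -
  let ?R1 = "R(12 := Suc a + 20, 15 := 0, 4 := k)"
  have 1: "run search_program 4 (config_at 30 R w) = return_pmf (config_at 34 ?R1 w)"
    using R by (simp add: exec_simps stores_def)
  obtain R2 where
    2: "run search_program (6 * k + 1) (config_at 34 ?R1 w) = return_pmf (config_at 40 R2 w)"
    and a2: "agree_off {4, 10, 12, 15} ?R1 R2" and p2: "R2 12 = Suc a + 20 + k * d"
    and s2: "R2 15 = (\<Sum>j<k. ?R1 (Suc a + 20 + j * d))"
    using sum_loop[of ?R1 k w] R by (auto simp: stores_def)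
  have off2: "agree_off {4, 10, 12, 15} R R2" using a2 by (simp add: agree_off_upd)
  have R2: "R2 0 = k" "R2 1 = 1" "R2 9 = 0" "R2 16 = n + 20 + d" "R2 14 = Suc a"
    using off2 R by (auto simp: agree_off_def stores_def)
  \<comment> \<open>The summing loop leaves the address one term beyond the last one. The summand
    \<open>d\<close> in register 16 compensates for this.\<close>
  have kd: "k * d = (k - 1) * d + d" using k by (cases k) auto
  have le_iff: "R2 12 - R2 16 = 0 \<longleftrightarrow> Suc a + (k - 1) * d \<le> n"
    using p2 R2(4) kd by simp
  have sum: "R2 15 = (\<Sum>j<k. of_bool (f (Suc a + j * d)))" if "Suc a + (k - 1) * d \<le> n"
    unfolding s2
  proof (intro sum.cong refl)
    fix j assume "j \<in> {..<k}"
    then have "j * d \<le> (k - 1) * d" by (intro mult_right_mono) auto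
    with that have "Suc a + j * d \<le> n" by linarith
    then have "Suc a + j * d \<in> {1..n}" by simp
    then have "R (20 + (Suc a + j * d)) = of_bool (f (Suc a + j * d))"
      using R(1) unfolding stores_def by blast
    moreover have "20 + (Suc a + j * d) = Suc a + 20 + j * d" by simp
    ultimately have "R (Suc a + 20 + j * d) = of_bool (f (Suc a + j * d))" by metis
    then show "?R1 (Suc a + 20 + j * d) = of_bool (f (Suc a + j * d))" by simp
  qed
  have advance: "run search_program 2 (config_at 46 S w) = return_pmf (config_at 30 (S(14 := S 14 - S 1)) w)"
    if "S 9 = 0" for S
    using that by (simp add: exec_simps)
  \<comment> \<open>Truncated subtraction only detects that the sum is at least \<open>k\<close>.
    Together with this bound it decides equality.\<close>
  have sum_le: "(\<Sum>j<k. of_bool (f (Suc a + j * d))) \<le> k"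
    using sum_bounded_above[of "{..<k}" "\<lambda>j. of_bool (f (Suc a + j * d))" "1::nat"] by simp
  let ?S = "R2(10 := R2 12 - R2 16)" and ?S' = "R2(10 := k - R2 15)"
  have "\<exists>t R'. t \<le> 7 \<and> run search_program t (config_at 40 R2 w) =
      return_pmf (config_at (if bad_at k n f d (Suc a) then 59 else 30) R' w) \<and>
    agree_off {10, 14} R2 R' \<and> (\<not> bad_at k n f d (Suc a) \<longrightarrow> R' 14 = a)"
  proof (cases "Suc a + (k - 1) * d \<le> n")
    case False
    then have "run search_program 3 (config_at 40 R2 w) = return_pmf (config_at 46 ?S w)"
      using R2 le_iff by (simp add: exec_simps)
    from run_trans[OF this, of 2] advance[of ?S] R2
    have "run search_program 5 (config_at 40 R2 w) = return_pmf (config_at 30 (?S(14 := a)) w)"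
      by simp
    moreover have "\<not> bad_at k n f d (Suc a)" using False by (simp add: bad_at_def)
    moreover have "agree_off {10, 14} R2 (?S(14 := a))" by (simp add: agree_off_def)
    ultimately show ?thesis by (intro exI[of _ "5::nat"] exI[of _ "?S(14 := a)"]) simp
  next
    case True
    note sum = sum[OF True]
    have z: "R2 12 - R2 16 = 0" using True le_iff by blast
    consider (zero) "R2 15 = 0" | (full) "R2 15 \<noteq> 0" "R2 15 = k" | (ok) "R2 15 \<noteq> 0" "R2 15 \<noteq> k" by blast
    then show ?thesis
    proof cases
      case zero
      then have "bad_at k n f d (Suc a)" using True sum by (simp add: bad_at_def mono_at_iff_sum)
      moreover have "run search_program 3 (config_at 40 R2 w) = return_pmf (config_at 59 ?S w)"
        using z zero by (simp add: exec_simps)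
      ultimately show ?thesis by (intro exI[of _ "3::nat"] exI[of _ ?S]) (simp add: agree_off_def)
    next
      case full
      then have "bad_at k n f d (Suc a)" using True sum by (simp add: bad_at_def mono_at_iff_sum)
      moreover have "run search_program 5 (config_at 40 R2 w) = return_pmf (config_at 59 ?S' w)"
        using z full R2 by (simp add: exec_simps)
      ultimately show ?thesis by (intro exI[of _ "5::nat"] exI[of _ ?S']) (simp add: agree_off_def)
    next
      case ok
      then have "\<not> bad_at k n f d (Suc a)" using sum by (simp add: bad_at_def mono_at_iff_sum)
      have "k - R2 15 \<noteq> 0" using ok sum sum_le by simp
      then have "run search_program 5 (config_at 40 R2 w) = return_pmf (config_at 46 ?S' w)"
        using z ok R2 by (simp add: exec_simps)
      from run_trans[OF this, of 2] advance[of ?S'] R2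
      have "run search_program 7 (config_at 40 R2 w) = return_pmf (config_at 30 (?S'(14 := a)) w)"
        by simp
      moreover have "agree_off {10, 14} R2 (?S'(14 := a))" by (simp add: agree_off_def)
      ultimately show ?thesis using \<open>\<not> bad_at k n f d (Suc a)\<close>
        by (intro exI[of _ "7::nat"] exI[of _ "?S'(14 := a)"]) simp
    qed
  qed
  then obtain t R' where t: "t \<le> 7" and 3: "run search_program t (config_at 40 R2 w) =
      return_pmf (config_at (if bad_at k n f d (Suc a) then 59 else 30) R' w)"
    and a3: "agree_off {10, 14} R2 R'" and R': "\<not> bad_at k n f d (Suc a) \<longrightarrow> R' 14 = a" by blast
  have "run search_program (4 + ((6 * k + 1) + t)) (config_at 30 R w) =
      return_pmf (config_at (if bad_at k n f d (Suc a) then 59 else 30) R' w)"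
    unfolding run_trans[OF 1] run_trans[OF 2] by (rule 3)
  moreover have "4 + ((6 * k + 1) + t) \<le> 6 * k + 14" using t by simp
  moreover have "agree_off {4, 10, 12, 14, 15} R R'"
    by (rule agree_off_trans[OF agree_off_mono[OF off2] agree_off_mono[OF a3]]) auto
  ultimately show ?thesis using R' by blast
qed

lemma bex_1_Suc: "(\<exists>x\<in>{1..Suc n}. P x) \<longleftrightarrow> P (Suc n) \<or> (\<exists>x\<in>{1..n}. P x)"
  by (simp add: atLeastAtMostSuc_conv)

lemma start_loop:
  assumes k: "k \<ge> 1" and R: "stores k n f R" "R 13 = d" "R 16 = n + 20 + d" "R 14 = a"
  shows "\<exists>t R'. t \<le> a * (6 * k + 14) + 1 \<and>
    run search_program t (config_at 30 R w) =
      return_pmf (config_at (if \<exists>b\<in>{1..a}. bad_at k n f d b then 59 else 48) R' w) \<and>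
    agree_off {4, 10, 12, 14, 15} R R'"
  using R
proof (induction a arbitrary: R)
  case 0
  then have "run search_program 1 (config_at 30 R w) = return_pmf (config_at 48 R w)"
    by (simp add: exec_simps)
  then show ?case using agree_off_refl by fastforce
next
  case (Suc a)
  obtain t R' where t: "t \<le> 6 * k + 14"
    and 1: "run search_program t (config_at 30 R w) =
      return_pmf (config_at (if bad_at k n f d (Suc a) then 59 else 30) R' w)"
    and a1: "agree_off {4, 10, 12, 14, 15} R R'" and R': "\<not> bad_at k n f d (Suc a) \<longrightarrow> R' 14 = a"
    using check_progression[OF k Suc.prems] by blast
  show ?case
  proof (cases "bad_at k n f d (Suc a)")
    case True
    then show ?thesis unfolding bex_1_Suc using t 1 a1 by (intro exI[of _ t] exI[of _ R']) simp
  next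
    case False
    have "stores k n f R'" using stores_agree_off[OF Suc.prems(1) a1] by simp
    moreover have "R' 13 = d" "R' 16 = n + 20 + d"
      using a1 Suc.prems by (simp_all add: agree_off_def)
    ultimately obtain u R'' where u: "u \<le> a * (6 * k + 14) + 1"
      and 2: "run search_program u (config_at 30 R' w) =
        return_pmf (config_at (if \<exists>b\<in>{1..a}. bad_at k n f d b then 59 else 48) R'' w)"
      and a2: "agree_off {4, 10, 12, 14, 15} R' R''"
      using Suc.IH[of R'] R' False by blast
    have "run search_program t (config_at 30 R w) = return_pmf (config_at 30 R' w)"
      using 1 False by simp
    from run_trans[OF this, of u] 2 False
    have "run search_program (t + u) (config_at 30 R w) =
        return_pmf (config_at (if \<exists>b\<in>{1..Suc a}. bad_at k n f d b then 59 else 48) R'' w)"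
      unfolding bex_1_Suc by simp
    moreover have "t + u \<le> Suc a * (6 * k + 14) + 1" using t u by simp
    moreover have "agree_off {4, 10, 12, 14, 15} R R''" using agree_off_trans[OF a1 a2] .
    ultimately show ?thesis by blast
  qed
qed

text \<open>Each difference takes 3 steps of preparation, the loop over \<open>n\<close> starts with
  its exit jump, and 2 steps to decrease the difference. This explains the summand 6.\<close>

lemma difference_loop:
  assumes k: "k \<ge> 1" and R: "stores k n f R" "R 13 = d"
  shows "\<exists>t R'. t \<le> d * (n * (6 * k + 14) + 6) + 1 \<and>
    run search_program t (config_at 27 R w) =
      return_pmf (config_at (if \<exists>e\<in>{1..d}. \<exists>b\<in>{1..n}. bad_at k n f e b then 59 else 50) R' w) \<and>
    stores k n f R'"
  using R
proof (induction d arbitrary: R)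
  case 0
  then have "run search_program 1 (config_at 27 R w) = return_pmf (config_at 50 R w)"
    by (simp add: exec_simps)
  then show ?case using 0 by (intro exI[of _ 1] exI[of _ R]) simp
next
  case (Suc d)
  let ?R1 = "R(14 := n, 16 := n + 20 + Suc d)"
  have 1: "run search_program 3 (config_at 27 R w) = return_pmf (config_at 30 ?R1 w)"
    using Suc.prems by (simp add: exec_simps stores_def)
  have s1: "stores k n f ?R1"
    by (rule stores_agree_off[OF Suc.prems(1), of "{14, 16}"]) (auto simp: agree_off_def)
  obtain t R2 where t: "t \<le> n * (6 * k + 14) + 1"
    and 2: "run search_program t (config_at 30 ?R1 w) =
      return_pmf (config_at (if \<exists>b\<in>{1..n}. bad_at k n f (Suc d) b then 59 else 48) R2 w)"
    and a2: "agree_off {4, 10, 12, 14, 15} ?R1 R2"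
    using start_loop[OF k s1, of "Suc d" n w] Suc.prems(2) by auto
  have s2: "stores k n f R2" using stores_agree_off[OF s1 a2] by simp
  have "R2 13 = Suc d" using a2 Suc.prems(2) by (simp add: agree_off_def)
  show ?case
  proof (cases "\<exists>b\<in>{1..n}. bad_at k n f (Suc d) b")
    case True
    have "run search_program (3 + t) (config_at 27 R w) = return_pmf (config_at 59 R2 w)"
      unfolding run_trans[OF 1] using 2 True by simp
    then show ?thesis unfolding bex_1_Suc using t s2 True
      by (intro exI[of _ "3 + t"] exI[of _ R2]) simp
  next
    case False
    let ?R3 = "R2(13 := d)"
    have nobad: "run search_program t (config_at 30 ?R1 w) = return_pmf (config_at 48 R2 w)"
      using 2 False by simp
    have 3: "run search_program 2 (config_at 48 R2 w) = return_pmf (config_at 27 ?R3 w)"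
      using s2 \<open>R2 13 = Suc d\<close> by (simp add: exec_simps stores_def)
    have s3: "stores k n f ?R3"
      by (rule stores_agree_off[OF s2, of "{13}"]) (auto simp: agree_off_def)
    obtain u R4 where u: "u \<le> d * (n * (6 * k + 14) + 6) + 1"
      and 4: "run search_program u (config_at 27 ?R3 w) =
        return_pmf (config_at (if \<exists>e\<in>{1..d}. \<exists>b\<in>{1..n}. bad_at k n f e b then 59 else 50) R4 w)"
      and s4: "stores k n f R4"
      using Suc.IH[OF s3 fun_upd_same] by blast
    have "run search_program (3 + (t + (2 + u))) (config_at 27 R w) =
        return_pmf (config_at (if \<exists>e\<in>{1..Suc d}. \<exists>b\<in>{1..n}. bad_at k n f e b then 59 else 50) R4 w)"
      unfolding run_trans[OF 1] run_trans[OF nobad] run_trans[OF 3] 4 bex_1_Suc using False by simp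
    moreover have "3 + (t + (2 + u)) \<le> Suc d * (n * (6 * k + 14) + 6) + 1" using t u by simp
    ultimately show ?thesis using s4 by blast
  qed
qed

section \<open>Output and the complete run\<close>

text \<open>As in \<open>sum_loop\<close>, addresses above 20 keep the cells to be printed apart
  from the registers that change.\<close>

lemma print_loop:
  assumes "R 1 = 1" "R 9 = 0" "R 4 = i" "R 12 > 20"
  shows "\<exists>R'. run search_program (6 * i + 1) (config_at 53 R w) =
    return_pmf (config_at 60 R' (w @ map R [R 12..<R 12 + i]))"
  using assms
proof (induction i arbitrary: R w)
  case 0
  then have "run search_program (6 * 0 + 1) (config_at 53 R w) = return_pmf (config_at 60 R w)"
    by (simp add: exec_simps)
  then show ?case by fastforce
next
  case (Suc i)
  let ?R = "R(10 := R (R 12), 12 := Suc (R 12), 4 := i)"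
  have 1: "run search_program 6 (config_at 53 R w) = return_pmf (config_at 53 ?R (w @ [R (R 12)]))"
    using Suc.prems by (simp add: exec_simps)
  have "?R 1 = 1" "?R 9 = 0" "?R 4 = i" "?R 12 > 20" using Suc.prems by simp_all
  from Suc.IH[OF this] obtain R' where
    2: "run search_program (6 * i + 1) (config_at 53 ?R (w @ [R (R 12)])) =
      return_pmf (config_at 60 R' ((w @ [R (R 12)]) @ map ?R [?R 12..<?R 12 + i]))" by blast
  have "map ?R [?R 12..<?R 12 + i] = map R [Suc (R 12)..<R 12 + Suc i]"
    using Suc.prems(4) by (intro map_cong) auto
  moreover have "[R 12..<R 12 + Suc i] = R 12 # [Suc (R 12)..<R 12 + Suc i]"
    by (rule upt_conv_Cons) simp
  ultimately have tape: "(w @ [R (R 12)]) @ map ?R [?R 12..<?R 12 + i] = w @ map R [R 12..<R 12 + Suc i]"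
    by (simp only: append_assoc append.simps list.map)
  have "run search_program (6 + (6 * i + 1)) (config_at 53 R w) =
      return_pmf (config_at 60 R' (w @ map R [R 12..<R 12 + Suc i]))"
    unfolding run_trans[OF 1] 2 tape ..
  moreover have "6 + (6 * i + 1) = 6 * Suc i + 1" by simp
  ultimately show ?case by metis
qed

text \<open>Runs that halt early are padded by idle steps to a time that does not depend on
  \<open>f\<close>. This allows the phase to be composed with the random outcome of
  \<open>coin_loop\<close>.\<close>

lemma run_verification_phase:
  assumes k: "k \<ge> 1" and R: "stores k n f R"
  shows "\<exists>c. run search_program (n * (n * (6 * k + 14) + 6) + 6 * n + 7) (config_at 26 R []) = return_pmf c
    \<and> halted search_program c
    \<and> tape c = (if \<exists>d\<in>{1..n}. \<exists>a\<in>{1..n}. bad_at k n f d a then failure_word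
                else coloring_word n (coloring_of f))"
proof -
  let ?T = "n * (n * (6 * k + 14) + 6)"
  let ?R1 = "R(13 := n)"
  have 1: "run search_program 1 (config_at 26 R []) = return_pmf (config_at 27 ?R1 [])"
    using R by (simp add: exec_simps stores_def)
  have s1: "stores k n f ?R1"
    by (rule stores_agree_off[OF R, of "{13}"]) (auto simp: agree_off_def)
  obtain t R2 where t: "t \<le> ?T + 1" and
    2: "run search_program t (config_at 27 ?R1 []) =
      return_pmf (config_at (if \<exists>d\<in>{1..n}. \<exists>a\<in>{1..n}. bad_at k n f d a then 59 else 50) R2 [])"
    and s2: "stores k n f R2"
    using difference_loop[OF k s1, of n "[]"] by auto
  show ?thesis
  proof (cases "\<exists>d\<in>{1..n}. \<exists>a\<in>{1..n}. bad_at k n f d a")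
    case True
    have nobad: "run search_program t (config_at 27 ?R1 []) = return_pmf (config_at 59 R2 [])"
      using 2 True by simp
    have 3: "run search_program 1 (config_at 59 R2 []) = return_pmf (config_at 60 R2 failure_word)"
      using s2 by (simp add: exec_simps stores_def failure_word_def)
    have "run search_program (1 + (t + 1)) (config_at 26 R []) = return_pmf (config_at 60 R2 failure_word)"
      unfolding run_trans[OF 1] run_trans[OF nobad] by (rule 3)
    moreover have h: "halted search_program (config_at 60 R2 failure_word)"
      by (simp add: halted_search_program)
    ultimately have "run search_program (?T + 6 * n + 7) (config_at 26 R []) =
        return_pmf (config_at 60 R2 failure_word)"
      by (rule run_halted_mono) (use t in simp)
    then show ?thesis using h True by auto
  next
    case False
    let ?R3 = "R2(12 := 21, 4 := n)"
    have nobad: "run search_program t (config_at 27 ?R1 []) = return_pmf (config_at 50 R2 [])"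
      using 2 False by simp
    have 3: "run search_program 3 (config_at 50 R2 []) = return_pmf (config_at 53 ?R3 [1])"
      using s2 by (simp add: exec_simps stores_def)
    obtain R4 where 4: "run search_program (6 * n + 1) (config_at 53 ?R3 [1]) =
        return_pmf (config_at 60 R4 ([1] @ map ?R3 [21..<21 + n]))"
      using print_loop[of ?R3 n "[1]"] s2 by (auto simp: stores_def)
    have "R2 (21 + i) = of_bool (f (Suc i))" if "i < n" for i
    proof -
      have "Suc i \<in> {1..n}" using that by simp
      then have "R2 (20 + Suc i) = of_bool (f (Suc i))" using s2 unfolding stores_def by blast
      then show ?thesis by simp
    qed
    then have "map ?R3 [21..<21 + n] = map (coloring_of f) [1..<Suc n]"
      by (intro nth_equalityI) (simp_all del: upt_Suc)
    then have w: "[1] @ map ?R3 [21..<21 + n] = coloring_word n (coloring_of f)"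
      by (simp add: coloring_word_def)
    have "run search_program (1 + (t + (3 + (6 * n + 1)))) (config_at 26 R []) =
        return_pmf (config_at 60 R4 (coloring_word n (coloring_of f)))"
      unfolding run_trans[OF 1] run_trans[OF nobad] run_trans[OF 3] w[symmetric] by (rule 4)
    moreover have h: "halted search_program (config_at 60 R4 (coloring_word n (coloring_of f)))"
      by (simp add: halted_search_program)
    ultimately have "run search_program (?T + 6 * n + 7) (config_at 26 R []) =
        return_pmf (config_at 60 R4 (coloring_word n (coloring_of f)))"
      by (rule run_halted_mono) (use t in simp)
    then show ?thesis using h False by auto
  qed
qed

lemma stores_with_coins:
  assumes "R 0 = k" "R 1 = 1" "R 2 = 20" "R 5 = n" "R 9 = 0" "R 11 = n + 20"
  shows "stores k n f (with_coins n f R)"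
  using assms by (simp add: stores_def with_coins_def)

text \<open>For \<open>k = 1\<close> the size condition forces \<open>n = 0\<close>, where neither
  side can hold.\<close>

lemma bad_at_iff_has_mono_AP:
  assumes "k \<ge> 1" "3 * n\<^sup>2 \<le> k * 2 ^ (k - 1)"
  shows "(\<exists>d\<in>{1..n}. \<exists>a\<in>{1..n}. bad_at k n f d a) \<longleftrightarrow> has_mono_AP k n (coloring_of f)"
proof (cases "k = 1")
  case True
  with assms(2) have "3 * n\<^sup>2 \<le> 1" by simp
  then have "n\<^sup>2 = 0" by linarith
  then have "n = 0" by simp
  then show ?thesis using no_mono_AP_0[OF assms(1)] by simp
next
  case False
  with assms(1) have "k \<ge> 2" by simp
  then show ?thesis by (simp add: has_mono_AP_coloring_of_iff bad_at_def)
qed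

lemma run_search_program:
  assumes k: "k \<ge> 1" and n: "3 * n\<^sup>2 \<le> k * 2 ^ (k - 1)" "k * 2 ^ (k - 1) < 3 * (n + 1)\<^sup>2"
  shows "\<exists>t c. t \<le> 6 * k * n\<^sup>2 + 14 * n\<^sup>2 + 24 * n + 4 * k + 22 \<and>
    run search_program t (initial k) = map_pmf c (coins n) \<and>
    (\<forall>f. halted search_program (c f) \<and>
      tape (c f) = (if proper_coloring k n (coloring_of f) then coloring_word n (coloring_of f)
                    else failure_word))"
proof -
  obtain R where
    1: "run search_program (4 * (k - 1) + 6 * n + 13) (initial k) = return_pmf (config_at 20 R [])"
    and R: "R 0 = k" "R 1 = 1" "R 2 = 20" "R 5 = n" "R 9 = 0" "R 11 = n + 20" "R 12 = n + 20"
    using run_arithmetic_phase[OF k n] by blast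
  note 2 = coin_loop[OF R(2,3,5,7), of "[]"]
  let ?t = "n * (n * (6 * k + 14) + 6) + 6 * n + 7"
  have "\<exists>c. run search_program ?t (config_at 26 (with_coins n f R) []) = return_pmf c
    \<and> halted search_program c
    \<and> tape c = (if proper_coloring k n (coloring_of f) then coloring_word n (coloring_of f)
                else failure_word)" for f
    using run_verification_phase[OF k stores_with_coins[OF R(1-6)], of f]
    unfolding bad_at_iff_has_mono_AP[OF k n(1)] proper_coloring_def
    by (auto simp: two_coloring_coloring_of)
  then obtain c where
    3: "\<And>f. run search_program ?t (config_at 26 (with_coins n f R) []) = return_pmf (c f)"
    and c: "\<And>f. halted search_program (c f)"
      "\<And>f. tape (c f) = (if proper_coloring k n (coloring_of f) then coloring_word n (coloring_of f)
                else failure_word)"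
    by metis
  \<comment> \<open>Only the coin loop is random, so the law of the whole run is the image of
    \<open>coins n\<close> under the map \<open>c\<close> to final configurations.\<close>
  have "run search_program ((4 * (k - 1) + 6 * n + 13) + ((6 * n + 2) + ?t)) (initial k) = map_pmf c (coins n)"
    unfolding run_trans[OF 1] run_add[of _ "6 * n + 2"] 2 map_pmf_def bind_assoc_pmf bind_return_pmf 3 ..
  moreover have "(4 * (k - 1) + 6 * n + 13) + ((6 * n + 2) + ?t)
      \<le> 6 * k * n\<^sup>2 + 14 * n\<^sup>2 + 24 * n + 4 * k + 22"
    by (simp add: power2_eq_square algebra_simps)
  ultimately show ?thesis using c by blast
qed

section \<open>Numerical estimates and conclusion\<close>

lemma vdW_bound_power2:
  assumes "k \<ge> 1"
  shows "(vdW_bound k)\<^sup>2 = real (k * 2 ^ (k - 1)) / 3"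
proof -
  have "(2 powr ((real k - 1) / 2))\<^sup>2 = 2 powr (real k - 1)"
    by (simp add: power2_eq_square flip: powr_add)
  also have "\<dots> = 2 ^ (k - 1)"
    using assms by (simp add: of_nat_diff flip: powr_realpow)
  finally show ?thesis
    unfolding vdW_bound_def by (simp add: power_mult_distrib)
qed

lemma vdW_bound_nonneg: "vdW_bound k \<ge> 0"
  by (simp add: vdW_bound_def)

text \<open>Squaring removes both roots and turns the floor into the two integer inequalities that
  the machine tests.\<close>

lemma floor_vdW_bound:
  fixes k n :: nat
  assumes k: "k \<ge> 1" and n: "n = nat \<lfloor>vdW_bound k\<rfloor>"
  shows "real n \<le> vdW_bound k" "vdW_bound k < real n + 1"
    "3 * n\<^sup>2 \<le> k * 2 ^ (k - 1)" "k * 2 ^ (k - 1) < 3 * (n + 1)\<^sup>2"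
proof -
  show le: "real n \<le> vdW_bound k" and less: "vdW_bound k < real n + 1"
    using vdW_bound_nonneg[of k] unfolding n by linarith+
  have "(real n)\<^sup>2 \<le> (vdW_bound k)\<^sup>2" using le by (intro power_mono) auto
  then have "real (3 * n\<^sup>2) \<le> real (k * 2 ^ (k - 1))" using vdW_bound_power2[OF k] by simp
  then show "3 * n\<^sup>2 \<le> k * 2 ^ (k - 1)" by (simp only: of_nat_le_iff)
  have "(vdW_bound k)\<^sup>2 < (real n + 1)\<^sup>2"
    using less vdW_bound_nonneg by (intro power_strict_mono) auto
  then have "real (k * 2 ^ (k - 1)) < real (3 * (n + 1)\<^sup>2)" using vdW_bound_power2[OF k] by (simp add: add.commute)
  then show "k * 2 ^ (k - 1) < 3 * (n + 1)\<^sup>2" by (simp only: of_nat_less_iff)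
qed

text \<open>The running time also involves \<open>k\<close>, which has to be bounded polynomially in
  \<open>vdW_bound k\<close>.\<close>

lemma of_nat_le_vdW_bound_power2:
  assumes "k \<ge> 1"
  shows "real k \<le> 3 * (vdW_bound k)\<^sup>2"
proof -
  have "k * 1 \<le> k * 2 ^ (k - 1)" by (intro mult_left_mono) auto
  then have "real k \<le> real (k * 2 ^ (k - 1))" by (simp only: of_nat_le_iff mult_1_right)
  then show ?thesis using vdW_bound_power2[OF assms] by simp
qed

text \<open>Used with \<open>x\<close>, \<open>y\<close>, \<open>b\<close> for \<open>k\<close>,
  \<open>n\<close> and \<open>vdW_bound k\<close>. The coefficient 18 comes from
  \<open>6 * x * y\<^sup>2\<close>, and 26 is 14 plus the 12 from \<open>4 * x\<close>.\<close>

lemma running_time_le: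
  fixes b x y :: real
  assumes "0 \<le> x" "x \<le> 3 * b\<^sup>2" "0 \<le> y" "y \<le> b"
  shows "6 * x * y\<^sup>2 + 14 * y\<^sup>2 + 24 * y + 4 * x + 22 \<le> poly [:22, 24, 26, 0, 18:] b"
proof -
  have sq: "y\<^sup>2 \<le> b\<^sup>2" using assms by (intro power_mono) auto
  have "x * y\<^sup>2 \<le> (3 * b\<^sup>2) * b\<^sup>2" using assms sq by (intro mult_mono) auto
  then have "6 * x * y\<^sup>2 + 14 * y\<^sup>2 + 24 * y + 4 * x + 22
      \<le> 18 * (b\<^sup>2 * b\<^sup>2) + 14 * b\<^sup>2 + 24 * b + 12 * b\<^sup>2 + 22"
    using assms sq by linarith
  also have "\<dots> = poly [:22, 24, 26, 0, 18:] b" by (simp add: power2_eq_square algebra_simps)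
  finally show ?thesis .
qed

theorem theorem2p1:
  "(\<exists>(P :: program) (p :: real poly). \<forall>k::nat. k \<ge> 1 \<longrightarrow>
      (let n = nat \<lfloor>vdW_bound k\<rfloor> in
       \<exists>t::nat. real t \<le> poly p (vdW_bound k) \<and>
         terminates_within P k t \<and>
         (\<forall>w \<in> set_pmf (output_dist P k t).
            w = failure_word \<or> w \<in> proper_coloring_words k n) \<and>
         measure_pmf.prob (output_dist P k t) (proper_coloring_words k n) \<ge> 2 / 3))
   \<and> (\<forall>k::nat. k \<ge> 1 \<longrightarrow> real (vdW2 k) \<ge> vdW_bound k)"
proof (intro conjI exI[of _ search_program] exI[of _ "[:22, 24, 26, 0, 18:]"] allI impI)
  fix k :: nat assume k: "k \<ge> 1"
  define n where "n = nat \<lfloor>vdW_bound k\<rfloor>"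
  note n = floor_vdW_bound[OF k n_def]
  obtain t c where t: "t \<le> 6 * k * n\<^sup>2 + 14 * n\<^sup>2 + 24 * n + 4 * k + 22"
    and run: "run search_program t (initial k) = map_pmf c (coins n)"
    and c: "\<And>f. halted search_program (c f)"
      "\<And>f. tape (c f) = (if proper_coloring k n (coloring_of f) then coloring_word n (coloring_of f)
                    else failure_word)"
    using run_search_program[OF k n(3,4)] by blast
  have "real t \<le> real (6 * k * n\<^sup>2 + 14 * n\<^sup>2 + 24 * n + 4 * k + 22)"
    using t by (simp only: of_nat_le_iff)
  also have "\<dots> = 6 * real k * (real n)\<^sup>2 + 14 * (real n)\<^sup>2 + 24 * real n + 4 * real k + 22" by simp
  also have "\<dots> \<le> poly [:22, 24, 26, 0, 18:] (vdW_bound k)"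
    by (rule running_time_le) (use n(1) of_nat_le_vdW_bound_power2[OF k] in auto)
  finally have time: "real t \<le> poly [:22, 24, 26, 0, 18:] (vdW_bound k)" .
  have halt: "terminates_within search_program k t"
    unfolding terminates_within_def run using c(1) by auto
  have out: "output_dist search_program k t = map_pmf (\<lambda>f. tape (c f)) (coins n)"
    unfolding output_dist_def run by (simp add: map_pmf_comp)
  have correct: "\<forall>w \<in> set_pmf (output_dist search_program k t).
      w = failure_word \<or> w \<in> proper_coloring_words k n"
    unfolding out proper_coloring_words_def using c(2) by auto
  have "2 / 3 \<le> measure_pmf.prob (coins n) {f. proper_coloring k n (coloring_of f)}"
    by (rule prob_proper_coloring[OF k n(3)])
  also have "\<dots> \<le> measure_pmf.prob (coins n) ((\<lambda>f. tape (c f)) -` proper_coloring_words k n)"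
    unfolding proper_coloring_words_def using c(2)
    by (intro measure_pmf.finite_measure_mono) auto
  also have "\<dots> = measure_pmf.prob (output_dist search_program k t) (proper_coloring_words k n)"
    unfolding out by simp
  finally have "measure_pmf.prob (output_dist search_program k t) (proper_coloring_words k n) \<ge> 2 / 3" .
  with time halt correct show "let n = nat \<lfloor>vdW_bound k\<rfloor> in
       \<exists>t::nat. real t \<le> poly [:22, 24, 26, 0, 18:] (vdW_bound k) \<and>
         terminates_within search_program k t \<and>
         (\<forall>w \<in> set_pmf (output_dist search_program k t).
            w = failure_word \<or> w \<in> proper_coloring_words k n) \<and>
         measure_pmf.prob (output_dist search_program k t) (proper_coloring_words k n) \<ge> 2 / 3"
    unfolding Let_def n_def[symmetric] by blast
next
  fix k :: nat assume k: "k \<ge> 1"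
  define n where "n = nat \<lfloor>vdW_bound k\<rfloor>"
  note n = floor_vdW_bound[OF k n_def]
  \<comment> \<open>An event of positive probability is nonempty.\<close>
  have "{f. proper_coloring k n (coloring_of f)} \<noteq> {}"
    using prob_proper_coloring[OF k n(3)] by (metis measure_empty not_numeral_le_zero zero_less_divide_iff not_le zero_less_numeral)
  then obtain f where "proper_coloring k n (coloring_of f)" by blast
  \<comment> \<open>The strict inequality gives \<open>n + 1 \<le> vdW2 k\<close>, which makes up
    for the rounding in \<open>n\<close>.\<close>
  from less_vdW2[OF this] n(2) show "real (vdW2 k) \<ge> vdW_bound k" by linarith
qed

end
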